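(* Let $X_1,\dots,X_n$ be i.i.d. random variables with distribution $P^0$ on a measurable space $(\mathbb{X},\mathcal{X})$, and consider a countable collection of models $\mathcal{M}_K=\{P_{\theta_K}:\theta_K\in\Theta_K\}$, $K\ge 1$, with prior $\pi=\sum_{K\ge1}\pi_K\Pi_K$ and, for each $K$, variational set $\mathcal{F}_K$, tempered posteriors, variational approximations $\tilde\pi^K_{n,\alpha}(\cdot|X_1^n)$ and selected index $\hat K$ as described in the context. Assume there exist $K_0\ge1$ and $\theta^0\in\Theta_{K_0}$ with $P^0=P_{\theta^0}$, and assume there exist $r_n>0$ and a distribution $\rho_{K_0,n}\in\mathcal{F}_{K_0}$ such that $$\int \mathrm{KL}(P^0,P_{\theta_{K_0}})\,\rho_{K_0,n}(d\theta_{K_0})\le r_n\quad\text{and}\quad \mathrm{KL}(\rho_{K_0,n},\Pi_{K_0})\le n r_n.$$ Then for any $\alpha\in(0,1)$, $$\mathbb{E}\Big[\int D_\alpha(P_\theta,P^0)\,\tilde\pi^{\hat K}_{n,\alpha}(d\theta|X_1^n)\Big]\le \frac{1+\alpha}{1-\alpha}\,r_n+\frac{\log(1/\pi_{K_0})}{n(1-\alpha)},$$ where the expectation is with respect to $X_1,\dots,X_n$ i.i.d. $\sim P^0$.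
   Context: Data: $X_1^n=(X_1,\dots,X_n)$. Models: for each $K\ge1$, $\Theta_K$ is a parameter set and $\mathcal{M}_K=\{P_{\theta_K}:\theta_K\in\Theta_K\}$ a family of probability distributions on $\mathbb{X}$ (no further assumptions; parameter sets may overlap). Prior: weights $\pi_K>0$ with $\sum_K\pi_K=1$ and conditional priors $\Pi_K$ on $\Theta_K$; $\pi=\sum_K\pi_K\Pi_K$ on $\bigcup_K\Theta_K$. Likelihood $L_n(\theta_K)=\prod_{i=1}^n P_{\theta_K}(X_i)$ (densities w.r.t. a common dominating measure), log-likelihood $\ell_n=\log L_n$. For $\alpha\in(0,1)$, the tempered posterior on $\Theta_K$ is $\pi^K_{n,\alpha}(d\theta_K|X_1^n)\propto L_n(\theta_K)^\alpha\Pi_K(d\theta_K)$. For each $K$, $\mathcal{F}_K$ is a given set of probability distributions on $\Theta_K$, and the variational approximation is $\tilde\pi^K_{n,\alpha}(\cdot|X_1^n)=\arg\min_{\rho_K\in\mathcal{F}_K}\mathrm{KL}(\rho_K,\pi^K_{n,\alpha}(\cdot|X_1^n))$, equivalently $\arg\max_{\rho_K\in\mathcal{F}_K}\{\alpha\int\ell_n(\theta_K)\rho_K(d\theta_K)-\mathrm{KL}(\rho_K,\Pi_K)\}$. Define $\mathrm{ELBO}(K)=\alpha\int\ell_n(\theta_K)\tilde\pi^K_{n,\alpha}(d\theta_K|X_1^n)-\mathrm{KL}(\tilde\pi^K_{n,\alpha}(\cdot|X_1^n),\Pi_K)$ and $\hat K=\arg\max_{K\ge1}\{\mathrm{ELBO}(K)-\log(1/\pi_K)\}$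 (all these optimizers are assumed to exist). $\mathrm{KL}(P,R)=\int\log(dP/dR)\,dP$ if $P\ll R$ and $+\infty$ otherwise. For $\alpha\neq1$, the Rényi divergence is $D_\alpha(P,R)=\frac{1}{\alpha-1}\log\int(dP/dR)^{\alpha-1}dP$ if $P\ll R$ and $+\infty$ otherwise.
   Formalization: The Rényi divergence is taken as (1/(α−1)) log ∫ p^α r^{1−α} dμ for densities p, r, without the convention D_α(P,R)=+∞ when P is not absolutely continuous w.r.t. R; with that convention the bound fails for α<1. The two definitions agree when P≪R. *)

theory Defs
  imports "HOL-Probability.Probability"
begin

text \<open>Extended logarithm: log 0 = -infinity (densities are nonnegative).\<close>
definition elog :: "real \<Rightarrow> ereal" where
  "elog t = (if 0 < t then ereal (ln t) else -\<infinity>)"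

definition eintegral :: "'a measure \<Rightarrow> ('a \<Rightarrow> ereal) \<Rightarrow> ereal" where
  "eintegral M f = enn2ereal (\<integral>\<^sup>+ t. e2ennreal (f t) \<partial>M) - enn2ereal (\<integral>\<^sup>+ t. e2ennreal (- f t) \<partial>M)"

definition KL_div :: "'a measure \<Rightarrow> 'a measure \<Rightarrow> ereal" where
  "KL_div P R = (if sets P = sets R \<and> absolutely_continuous R P
       then eintegral P (\<lambda>t. elog (enn2real (RN_deriv R P t))) else \<infinity>)"

text \<open>Renyi divergence of order alpha in (0,1) between distributions with densities p, r
  w.r.t. the dominating measure mu: 1/(alpha-1) log int p^alpha r^(1-alpha) dmu
  (= +infinity when the integral vanishes).  When P << R this equals
  1/(alpha-1) log int (dP/dR)^(alpha-1) dP.\<close>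
definition renyi :: "'x measure \<Rightarrow> real \<Rightarrow> ('x \<Rightarrow> real) \<Rightarrow> ('x \<Rightarrow> real) \<Rightarrow> ereal" where
  "renyi \<mu> \<alpha> p r =
     (let I = \<integral>\<^sup>+ x. ennreal (p x powr \<alpha> * r x powr (1 - \<alpha>)) \<partial>\<mu>
      in if I = 0 then \<infinity> else ereal (ln (enn2real I) / (\<alpha> - 1)))"

definition Pdist :: "'x measure \<Rightarrow> ('p \<Rightarrow> 'x \<Rightarrow> real) \<Rightarrow> 'p \<Rightarrow> 'x measure" where
  "Pdist \<mu> dens \<theta> = density \<mu> (\<lambda>x. ennreal (dens \<theta> x))"

definition loglik :: "('p \<Rightarrow> 'x \<Rightarrow> real) \<Rightarrow> nat \<Rightarrow> (nat \<Rightarrow> 'x) \<Rightarrow> 'p \<Rightarrow> ereal" where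
  "loglik dens n x \<theta> = (\<Sum>i<n. elog (dens \<theta> (x i)))"

definition elbo_obj :: "real \<Rightarrow> 'p measure \<Rightarrow> ('p \<Rightarrow> ereal) \<Rightarrow> 'p measure \<Rightarrow> ereal" where
  "elbo_obj \<alpha> Pri ll \<rho> =
     (if KL_div \<rho> Pri = \<infinity> then -\<infinity> else ereal \<alpha> * eintegral \<rho> ll - KL_div \<rho> Pri)"

end

theory Submission
  imports Defs
begin

text \<open>Write \<open>H(\<theta>, x)\<close> for the tempered likelihood ratio
  \<open>\<Prod>i<n. (dens \<theta> (x i) / dens \<theta>0 (x i)) powr \<alpha>\<close> divided by its expectation, so that
  \<open>ln H\<close> is \<open>\<alpha>\<close> times the log-likelihood ratio plus \<open>n (1 - \<alpha>)\<close> times the Renyi divergence. By Fubini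
  the mixture \<open>Z(x) = \<Sum>K. w K * \<integral> H(\<theta>, x) Pri K (d\<theta>)\<close> has expectation at most 1.
  Integrating \<open>ln u \<le> u - 1\<close> at \<open>u = w K * H / (d\<rho> / dPri K)\<close> against \<open>\<rho>\<close> bounds \<open>n (1 - \<alpha>)\<close> times the Renyi risk of
  \<open>\<rho>\<close>, for every \<open>K\<close> and \<open>\<rho>\<close> simultaneously, by \<open>\<alpha>\<close> times the log-likelihood at \<open>\<theta>0\<close> minus the penalised ELBO, plus
  \<open>Z(x) - 1\<close>; as only \<open>Z\<close>
  enters the bound, no measurability of the data-dependent \<open>\<rho>t\<close> and \<open>Khat\<close> is needed. Optimality
  then replaces the selected \<open>K\<close> and \<open>\<rho>\<close> by \<open>K0\<close> and \<open>\<rho>0\<close>, and taking expectations finishes.\<close>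

section \<open>Integrals of extended-real functions\<close>

lemma borel_measurable_elog[measurable]: "elog \<in> borel_measurable borel"
  unfolding elog_def by measurable

lemma eintegral_cong_AE:
  assumes "AE x in M. f x = g x"
  shows "eintegral M f = eintegral M g"
proof -
  have "(\<integral>\<^sup>+ x. e2ennreal (f x) \<partial>M) = (\<integral>\<^sup>+ x. e2ennreal (g x) \<partial>M)"
    by (rule nn_integral_cong_AE) (use assms in auto)
  moreover have "(\<integral>\<^sup>+ x. e2ennreal (- f x) \<partial>M) = (\<integral>\<^sup>+ x. e2ennreal (- g x) \<partial>M)"
    by (rule nn_integral_cong_AE) (use assms in auto)
  ultimately show ?thesis by (simp add: eintegral_def)
qed

lemma eintegral_ereal:
  assumes "integrable M h"
  shows "eintegral M (\<lambda>x. ereal (h x)) = ereal (\<integral>x. h x \<partial>M)"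
proof -
  have a: "e2ennreal (ereal (h x)) = ennreal (h x)" "e2ennreal (- ereal (h x)) = ennreal (- h x)" for x
    by (simp_all add: e2ennreal_ereal)
  have b: "(\<integral>\<^sup>+ x. ennreal (h x) \<partial>M) \<noteq> \<infinity>" "(\<integral>\<^sup>+ x. ennreal (- h x) \<partial>M) \<noteq> \<infinity>"
    using assms unfolding real_integrable_def by auto
  have c: "enn2ereal u = ereal (enn2real u)" if "u \<noteq> \<infinity>" for u
    using that by (cases u) (auto simp: enn2ereal_ennreal)
  show ?thesis
    unfolding eintegral_def a real_lebesgue_integral_def[OF assms]
    by (simp only: c[OF b(1)] c[OF b(2)] ereal_minus)
qed

text \<open>The integrable majorant \<open>b\<close> keeps the positive part finite, so an infinite
  negative part would force the value \<open>-\<infinity>\<close>. This extracts integrability of a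
  log-likelihood from a mere lower bound on its integral.\<close>

lemma integrable_of_eintegral:
  assumes [measurable]: "g \<in> borel_measurable M"
    and le: "AE x in M. g x \<le> ereal (b x)" and b: "integrable M b"
    and ne: "eintegral M g \<noteq> -\<infinity>"
  shows "AE x in M. g x = ereal (real_of_ereal (g x))"
    and "integrable M (\<lambda>x. real_of_ereal (g x))"
    and "eintegral M g = ereal (\<integral>x. real_of_ereal (g x) \<partial>M)"
proof -
  have "(\<integral>\<^sup>+ x. e2ennreal (g x) \<partial>M) \<le> (\<integral>\<^sup>+ x. ennreal (b x) \<partial>M)"
    by (rule nn_integral_mono_AE, use le in eventually_elim)
      (metis e2ennreal_ereal e2ennreal_mono)
  also have "\<dots> < \<infinity>" using b unfolding real_integrable_def by (auto simp: top.not_eq_extremum)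
  finally have p: "(\<integral>\<^sup>+ x. e2ennreal (g x) \<partial>M) \<noteq> \<infinity>" by simp
  have m: "(\<integral>\<^sup>+ x. e2ennreal (- g x) \<partial>M) \<noteq> \<infinity>"
  proof
    assume "(\<integral>\<^sup>+ x. e2ennreal (- g x) \<partial>M) = \<infinity>"
    with ne p show False
      by (cases "\<integral>\<^sup>+ x. e2ennreal (g x) \<partial>M") (auto simp: eintegral_def enn2ereal_ennreal)
  qed
  have "AE x in M. e2ennreal (- g x) \<noteq> \<infinity>"
    by (rule nn_integral_PInf_AE) (use m in auto)
  with le show ae: "AE x in M. g x = ereal (real_of_ereal (g x))"
  proof eventually_elim
    case (elim x) then show ?case by (cases "g x") auto
  qed
  have p': "(\<integral>\<^sup>+ x. e2ennreal (g x) \<partial>M) = (\<integral>\<^sup>+ x. ennreal (real_of_ereal (g x)) \<partial>M)"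
    by (rule nn_integral_cong_AE, use ae in eventually_elim) (metis e2ennreal_ereal)
  have m': "(\<integral>\<^sup>+ x. e2ennreal (- g x) \<partial>M) = (\<integral>\<^sup>+ x. ennreal (- real_of_ereal (g x)) \<partial>M)"
    by (rule nn_integral_cong_AE, use ae in eventually_elim) (metis e2ennreal_ereal uminus_ereal.simps(1))
  show int: "integrable M (\<lambda>x. real_of_ereal (g x))"
    unfolding real_integrable_def using p m p' m' by simp
  show "eintegral M g = ereal (\<integral>x. real_of_ereal (g x) \<partial>M)"
    using eintegral_cong_AE[OF ae] eintegral_ereal[OF int] by simp
qed

section \<open>Radon-Nikodym derivatives and finite Kullback-Leibler divergence\<close>

text \<open>Change of measure: the derivative cancels wherever it is nonzero. Its zero set
  contributes nothing on the left but may contribute on the right, hence an inequality.\<close>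

lemma nn_integral_divide_RN_deriv_le:
  assumes "prob_space P" "prob_space R" and s: "sets P = sets R" and ac: "absolutely_continuous R P"
    and g[measurable]: "g \<in> borel_measurable R"
  shows "(\<integral>\<^sup>+ x. g x / RN_deriv R P x \<partial>P) \<le> (\<integral>\<^sup>+ x. g x \<partial>R)"
proof -
  interpret P: prob_space P by fact
  interpret R: prob_space R by fact
  have "(\<integral>\<^sup>+ x. g x / RN_deriv R P x \<partial>P) = (\<integral>\<^sup>+ x. RN_deriv R P x * (g x / RN_deriv R P x) \<partial>R)"
    by (rule R.RN_deriv_nn_integral[OF ac s]) measurable
  also have "\<dots> \<le> (\<integral>\<^sup>+ x. g x \<partial>R)"
  proof (rule nn_integral_mono_AE, use R.RN_deriv_finite[OF P.sigma_finite_measure_axioms ac s] in eventually_elim)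
    case (elim x)
    then show ?case
      by (cases "RN_deriv R P x = 0") (auto simp: ennreal_times_divide ennreal_mult_divide_eq mult.commute)
  qed
  finally show ?thesis .
qed

lemma RN_deriv_pos_AE:
  assumes "prob_space P" "prob_space R" and s: "sets P = sets R" and ac: "absolutely_continuous R P"
  shows "AE x in P. RN_deriv R P x = ennreal (enn2real (RN_deriv R P x)) \<and> 0 < enn2real (RN_deriv R P x)"
proof -
  interpret P: prob_space P by fact
  interpret R: prob_space R by fact
  have fin: "AE x in P. RN_deriv R P x \<noteq> \<infinity>"
    using R.RN_deriv_finite[OF P.sigma_finite_measure_axioms ac s] absolutely_continuous_AE[OF s ac] by blast
  \<comment> \<open>\<open>P\<close> has density \<open>RN_deriv R P\<close>, so it cannot charge
    the zero set of that derivative.\<close>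
  have "AE x in density R (RN_deriv R P). RN_deriv R P x \<noteq> 0"
    by (subst AE_density) auto
  then have "AE x in P. RN_deriv R P x \<noteq> 0"
    unfolding R.density_RN_deriv[OF ac s] .
  with fin show ?thesis
  proof eventually_elim
    case (elim x) then show ?case by (cases "RN_deriv R P x") (auto simp: less_le)
  qed
qed

text \<open>The negative part of the log-density is always integrable:
  \<open>- ln f \<le> 1 / f\<close>, and \<open>1 / f\<close> has \<open>P\<close>-integral at most
  the total mass of \<open>R\<close>. Finiteness of the divergence then controls the positive
  part.\<close>

lemma KL_div_finiteD:
  fixes P R :: "'a measure"
  defines "f \<equiv> \<lambda>x. enn2real (RN_deriv R P x)"
  assumes P: "prob_space P" and R: "prob_space R" and fin: "KL_div P R \<noteq> \<infinity>"
  shows "sets P = sets R" "absolutely_continuous R P"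
    and "integrable P (\<lambda>x. ln (f x))"
    and "KL_div P R = ereal (\<integral>x. ln (f x) \<partial>P)"
proof -
  interpret P: prob_space P by fact
  interpret R: prob_space R by fact
  show s: "sets P = sets R" and ac: "absolutely_continuous R P"
    using fin by (auto simp: KL_div_def split: if_splits)
  have [measurable]: "f \<in> borel_measurable P" unfolding f_def using s by simp
  have pos: "AE x in P. RN_deriv R P x = ennreal (f x) \<and> 0 < f x"
    using RN_deriv_pos_AE[OF P R s ac] by (simp add: f_def)
  have KL: "KL_div P R = eintegral P (\<lambda>x. ereal (ln (f x)))"
    using s ac pos unfolding KL_div_def f_def[symmetric]
    by (auto intro!: eintegral_cong_AE simp: elog_def)
  have "(\<integral>\<^sup>+ x. ennreal (- ln (f x)) \<partial>P) \<le> (\<integral>\<^sup>+ x. 1 / RN_deriv R P x \<partial>P)"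
  proof (rule nn_integral_mono_AE, use pos in eventually_elim)
    case (elim x)
    then have "- ln (f x) \<le> 1 / f x"
      using ln_le_minus_one[of "1 / f x"] by (simp add: ln_div)
    then have "ennreal (- ln (f x)) \<le> ennreal (1 / f x)" by (rule ennreal_leI)
    also have "\<dots> = 1 / RN_deriv R P x"
      using elim divide_ennreal[of 1 "f x"] by simp
    finally show ?case .
  qed
  also have "\<dots> \<le> (\<integral>\<^sup>+ x. 1 \<partial>R)" by (rule nn_integral_divide_RN_deriv_le[OF P R s ac]) simp
  also have "\<dots> = 1" by (simp add: R.emeasure_space_1)
  finally have m: "(\<integral>\<^sup>+ x. ennreal (- ln (f x)) \<partial>P) \<noteq> \<infinity>" by (auto simp: top_unique)
  have p: "(\<integral>\<^sup>+ x. ennreal (ln (f x)) \<partial>P) \<noteq> \<infinity>"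
  proof
    assume "(\<integral>\<^sup>+ x. ennreal (ln (f x)) \<partial>P) = \<infinity>"
    then have "KL_div P R = \<infinity>"
      using m unfolding KL eintegral_def by (simp add: e2ennreal_ereal)
    with fin show False by simp
  qed
  show int: "integrable P (\<lambda>x. ln (f x))" unfolding real_integrable_def using m p by simp
  show "KL_div P R = ereal (\<integral>x. ln (f x) \<partial>P)" unfolding KL by (rule eintegral_ereal[OF int])
qed

section \<open>The variational inequality within one model\<close>

text \<open>One half of Donsker-Varadhan duality, with a divergence \<open>D\<close> carried along.
  In the application \<open>R\<close> is a prior, \<open>a\<close> is \<alpha> times the
  log-likelihood at the true parameter, and \<open>e\<close> is a lower bound for the ELBO. The
  exceptional points allowed by \<open>ratio\<close> are \<open>\<rho>\<close>-null:
  \<open>Hfin\<close> excludes \<open>H \<theta> = \<infinity>\<close>, and the finite lower bound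
  \<open>e\<close> excludes \<open>ll \<theta> = -\<infinity>\<close>.\<close>

lemma variational_bound:
  fixes \<rho> R :: "'p measure" and ll D :: "'p \<Rightarrow> ereal" and H :: "'p \<Rightarrow> ennreal"
  defines "S \<equiv> \<lambda>a e w. a - e + ln (1 / w) + w * enn2real (\<integral>\<^sup>+ \<theta>. H \<theta> \<partial>R) - 1"
  assumes \<rho>: "prob_space \<rho>" and R: "prob_space R"
    and ll[measurable]: "ll \<in> borel_measurable R" and H[measurable]: "H \<in> borel_measurable R"
    and pos: "0 < \<alpha>" "0 < c" "0 < w"
    and Hfin: "(\<integral>\<^sup>+ \<theta>. H \<theta> \<partial>R) \<noteq> \<infinity>"
    and ratio: "\<And>\<theta>. \<theta> \<in> space R \<Longrightarrow> ll \<theta> = -\<infinity> \<or> H \<theta> = \<infinity> \<or>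
      (\<exists>l h d. ll \<theta> = ereal l \<and> H \<theta> = ennreal h \<and> 0 < h \<and> D \<theta> = ereal d \<and> 0 \<le> d \<and> c * d + \<alpha> * l = a + ln h)"
    and e: "ereal e \<le> elbo_obj \<alpha> R ll \<rho>"
  shows "0 \<le> S a e w" and "(\<integral>\<^sup>+ \<theta>. e2ennreal (D \<theta>) \<partial>\<rho>) \<le> ennreal (S a e w / c)"
proof -
  interpret \<rho>: prob_space \<rho> by fact
  interpret R: prob_space R by fact
  define f where "f \<theta> = enn2real (RN_deriv R \<rho> \<theta>)" for \<theta>
  define v where "v = (\<lambda>\<theta>. enn2real (H \<theta> / RN_deriv R \<rho> \<theta>))"
  have KL: "KL_div \<rho> R \<noteq> \<infinity>" using e by (auto simp: elbo_obj_def)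
  note K = KL_div_finiteD[OF \<rho> R KL, folded f_def]
  have s[measurable_cong]: "sets \<rho> = sets R" by (rule K)
  have ln_f: "integrable \<rho> (\<lambda>\<theta>. ln (f \<theta>))" by (rule K)
  have f: "AE \<theta> in \<rho>. RN_deriv R \<rho> \<theta> = ennreal (f \<theta>) \<and> 0 < f \<theta>"
    using RN_deriv_pos_AE[OF \<rho> R K(1,2)] by (simp add: f_def)
  have [measurable]: "RN_deriv R \<rho> \<in> borel_measurable \<rho>"
    using borel_measurable_RN_deriv[of R \<rho>] measurable_cong_sets[OF s refl] by blast
  have [measurable]: "v \<in> borel_measurable \<rho>" unfolding v_def by measurable
  have "AE \<theta> in R. H \<theta> \<noteq> \<infinity>" by (rule nn_integral_PInf_AE) (use Hfin in auto)
  then have Hf: "AE \<theta> in \<rho>. H \<theta> \<noteq> \<infinity>" using absolutely_continuous_AE[OF K(1,2)] by blast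
  have v_le: "(\<integral>\<^sup>+ \<theta>. ennreal (v \<theta>) \<partial>\<rho>) \<le> (\<integral>\<^sup>+ \<theta>. H \<theta> \<partial>R)"
  proof -
    have "(\<integral>\<^sup>+ \<theta>. ennreal (v \<theta>) \<partial>\<rho>) \<le> (\<integral>\<^sup>+ \<theta>. H \<theta> / RN_deriv R \<rho> \<theta> \<partial>\<rho>)"
      unfolding v_def by (rule nn_integral_mono) (simp add: ennreal_enn2real_if)
    also have "\<dots> \<le> (\<integral>\<^sup>+ \<theta>. H \<theta> \<partial>R)"
      by (rule nn_integral_divide_RN_deriv_le[OF \<rho> R K(1,2) H])
    finally show ?thesis .
  qed
  have v_int: "integrable \<rho> v"
  proof (rule integrableI_bounded)
    have "(\<integral>\<^sup>+ \<theta>. ennreal (norm (v \<theta>)) \<partial>\<rho>) = (\<integral>\<^sup>+ \<theta>. ennreal (v \<theta>) \<partial>\<rho>)"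
      by (simp add: v_def)
    then show "(\<integral>\<^sup>+ \<theta>. ennreal (norm (v \<theta>)) \<partial>\<rho>) < \<infinity>"
      using v_le Hfin by (simp add: top.not_eq_extremum)
  qed simp
  have v_le': "(\<integral>\<theta>. v \<theta> \<partial>\<rho>) \<le> enn2real (\<integral>\<^sup>+ \<theta>. H \<theta> \<partial>R)"
    using enn2real_mono[OF v_le] Hfin
    by (subst integral_eq_nn_integral) (auto simp: v_def top.not_eq_extremum)
  \<comment> \<open>A majorant of \<open>c * d + \<alpha> * l = a + ln h\<close>: write
    \<open>ln h = ln f + ln (1 / w) + ln (w * h / f)\<close> and bound the last logarithm by its
    argument minus 1.\<close>
  define g where "g = (\<lambda>\<theta>. a + ln (f \<theta>) + ln (1 / w) + w * v \<theta> - 1)"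
  have g_int: "integrable \<rho> g" unfolding g_def using ln_f v_int by simp
  have key: "AE \<theta> in \<rho>. ll \<theta> = -\<infinity> \<or>
      (\<exists>l d. ll \<theta> = ereal l \<and> D \<theta> = ereal d \<and> 0 \<le> d \<and> c * d + \<alpha> * l \<le> g \<theta>)"
    using f Hf AE_space
  proof eventually_elim
    case (elim \<theta>)
    have "\<theta> \<in> space R" using elim(3) sets_eq_imp_space_eq[OF s] by simp
    from ratio[OF this] show ?case
    proof (elim disjE exE conjE)
      fix l h d assume *: "ll \<theta> = ereal l" "H \<theta> = ennreal h" "0 < h" "D \<theta> = ereal d" "0 \<le> d"
        "c * d + \<alpha> * l = a + ln h"
      have v: "v \<theta> = h / f \<theta>"
        using elim * unfolding v_def by (simp add: divide_ennreal)
      have "ln (w * (h / f \<theta>)) \<le> w * (h / f \<theta>) - 1"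
        using elim * pos by (intro ln_le_minus_one) simp
      then have "ln w + ln h - ln (f \<theta>) \<le> w * v \<theta> - 1"
        using elim * pos by (simp add: ln_mult ln_div v)
      then have "c * d + \<alpha> * l \<le> g \<theta>" using * pos by (simp add: g_def ln_div)
      with * show ?thesis by auto
    qed (use elim in auto)
  qed
  \<comment> \<open>Since \<open>0 \<le> d\<close>, the same majorant bounds the log-likelihood
    alone; together with the lower bound \<open>e\<close> this yields its integrability.\<close>
  have le: "AE \<theta> in \<rho>. ll \<theta> \<le> ereal (g \<theta> / \<alpha>)"
    using key
  proof eventually_elim
    case (elim \<theta>)
    then show ?case
    proof (elim disjE exE conjE)
      fix l d assume *: "ll \<theta> = ereal l" "0 \<le> d" "c * d + \<alpha> * l \<le> g \<theta>"
      have "0 \<le> c * d" using * pos by simp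
      then have "\<alpha> * l \<le> g \<theta>" using *(3) by linarith
      then show ?thesis using * pos by (simp add: field_simps)
    qed simp
  qed
  define k where "k = (\<integral>\<theta>. ln (f \<theta>) \<partial>\<rho>)"
  have e': "ereal e \<le> ereal \<alpha> * eintegral \<rho> ll - ereal k"
    using e KL K(4) by (simp add: elbo_obj_def k_def)
  then have ne: "eintegral \<rho> ll \<noteq> -\<infinity>" using pos by auto
  have ll': "ll \<in> borel_measurable \<rho>" by measurable
  note L = integrable_of_eintegral[OF ll' le _ ne]
  have gi: "integrable \<rho> (\<lambda>\<theta>. g \<theta> / \<alpha>)" using g_int by simp
  define l where "l = (\<lambda>\<theta>. real_of_ereal (ll \<theta>))"
  have l_int: "integrable \<rho> l" unfolding l_def by (rule L(2)[OF gi])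
  have e_le: "e \<le> \<alpha> * (\<integral>\<theta>. l \<theta> \<partial>\<rho>) - k" using e' by (simp add: L(3)[OF gi] l_def)
  have bnd: "AE \<theta> in \<rho>. 0 \<le> (g \<theta> - \<alpha> * l \<theta>) / c \<and> e2ennreal (D \<theta>) \<le> ennreal ((g \<theta> - \<alpha> * l \<theta>) / c)"
    using key L(1)[OF gi]
  proof eventually_elim
    case (elim \<theta>)
    then obtain d where *: "D \<theta> = ereal d" "0 \<le> d" "c * d + \<alpha> * l \<theta> \<le> g \<theta>"
      by (auto simp: l_def)
    then have "d \<le> (g \<theta> - \<alpha> * l \<theta>) / c" using pos by (simp add: field_simps)
    with * show ?case by (auto intro: ennreal_leI)
  qed
  have int: "integrable \<rho> (\<lambda>\<theta>. (g \<theta> - \<alpha> * l \<theta>) / c)" using g_int l_int by simp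
  \<comment> \<open>Here \<open>k\<close> is the divergence of \<open>\<rho>\<close> from
    \<open>R\<close>; it cancels against the \<open>k\<close> subtracted in \<open>e_le\<close>,
    which leaves a bound in which \<open>\<rho>\<close> enters only through
    \<open>e\<close>.\<close>
  have "(\<integral>\<theta>. g \<theta> \<partial>\<rho>) = a + k + ln (1 / w) + w * (\<integral>\<theta>. v \<theta> \<partial>\<rho>) - 1"
    unfolding g_def k_def using ln_f v_int by (simp add: \<rho>.prob_space)
  moreover have "w * (\<integral>\<theta>. v \<theta> \<partial>\<rho>) \<le> w * enn2real (\<integral>\<^sup>+ \<theta>. H \<theta> \<partial>R)"
    using v_le' pos by simp
  ultimately have le_S: "(\<integral>\<theta>. g \<theta> \<partial>\<rho>) - \<alpha> * (\<integral>\<theta>. l \<theta> \<partial>\<rho>) \<le> S a e w"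
    using e_le by (simp add: S_def)
  have I_eq: "(\<integral>\<theta>. (g \<theta> - \<alpha> * l \<theta>) / c \<partial>\<rho>) = ((\<integral>\<theta>. g \<theta> \<partial>\<rho>) - \<alpha> * (\<integral>\<theta>. l \<theta> \<partial>\<rho>)) / c"
    using g_int l_int by simp
  have I_le: "(\<integral>\<theta>. (g \<theta> - \<alpha> * l \<theta>) / c \<partial>\<rho>) \<le> S a e w / c"
    unfolding I_eq using le_S pos by (simp add: divide_right_mono)
  have "0 \<le> (\<integral>\<theta>. (g \<theta> - \<alpha> * l \<theta>) / c \<partial>\<rho>)"
    by (rule integral_nonneg_AE) (use bnd in auto)
  with I_le have "0 \<le> S a e w / c" by linarith
  then show "0 \<le> S a e w" using pos by (simp add: zero_le_divide_iff)
  have "(\<integral>\<^sup>+ \<theta>. e2ennreal (D \<theta>) \<partial>\<rho>) \<le> (\<integral>\<^sup>+ \<theta>. ennreal ((g \<theta> - \<alpha> * l \<theta>) / c) \<partial>\<rho>)"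
    by (rule nn_integral_mono_AE) (use bnd in auto)
  also have "\<dots> = ennreal (\<integral>\<theta>. (g \<theta> - \<alpha> * l \<theta>) / c \<partial>\<rho>)"
    by (rule nn_integral_eq_integral[OF int]) (use bnd in auto)
  also have "\<dots> \<le> ennreal (S a e w / c)" using I_le by (rule ennreal_leI)
  finally show "(\<integral>\<^sup>+ \<theta>. e2ennreal (D \<theta>) \<partial>\<rho>) \<le> ennreal (S a e w / c)" .
qed

section \<open>Density ratios and Renyi affinities\<close>

text \<open>Weighted AM-GM for \<open>t\<close> and 1, or equivalently the tangent at 1 to a concave
  power.\<close>

lemma powr_le_affine:
  fixes t \<alpha> :: real
  assumes "0 \<le> t" "0 < \<alpha>" "\<alpha> < 1"
  shows "t powr \<alpha> \<le> 1 - \<alpha> + \<alpha> * t"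
proof (cases "t = 0")
  case False
  define s where "s = 1 - \<alpha> + \<alpha> * t"
  have t: "0 < t" using False assms by simp
  have s: "0 < s" using assms t by (simp add: s_def add_pos_pos)
  \<comment> \<open>\<open>ln u \<le> u - 1\<close> is used at \<open>t / s\<close> and at
    \<open>1 / s\<close>; the weighted right-hand sides add up to 0 because \<open>s\<close> is the
    weighted mean of \<open>t\<close> and 1.\<close>
  have "\<alpha> * ln (t / s) \<le> \<alpha> * (t / s - 1)"
    using assms t s by (intro mult_left_mono ln_le_minus_one) auto
  moreover have "(1 - \<alpha>) * ln (1 / s) \<le> (1 - \<alpha>) * (1 / s - 1)"
    using assms t s by (intro mult_left_mono ln_le_minus_one) auto
  moreover have "\<alpha> * (t / s - 1) + (1 - \<alpha>) * (1 / s - 1) = 0"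
    using s by (simp add: field_simps) (simp add: s_def algebra_simps)
  ultimately have "\<alpha> * ln t \<le> ln s"
    using t s by (simp add: ln_div algebra_simps)
  then have "exp (\<alpha> * ln t) \<le> exp (ln s)" by (simp only: exp_le_cancel_iff)
  then have "exp (\<alpha> * ln t) \<le> s" using s by simp
  then show ?thesis using t by (simp add: powr_def s_def)
qed (use assms in auto)

text \<open>The reference measure need not be sigma-finite, so integrals against it are moved to the
  probability measure with density q before Fubini is used.\<close>

lemma nn_integral_ratio_le:
  fixes p q :: "'x \<Rightarrow> real"
  assumes [measurable]: "p \<in> borel_measurable \<mu>" "q \<in> borel_measurable \<mu>"
    and nn: "\<And>y. y \<in> space \<mu> \<Longrightarrow> 0 \<le> p y" "\<And>y. y \<in> space \<mu> \<Longrightarrow> 0 \<le> q y"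
  shows "(\<integral>\<^sup>+ y. ennreal (p y / q y) \<partial>density \<mu> (\<lambda>y. ennreal (q y))) \<le> (\<integral>\<^sup>+ y. ennreal (p y) \<partial>\<mu>)"
proof -
  have "(\<integral>\<^sup>+ y. ennreal (p y / q y) \<partial>density \<mu> (\<lambda>y. ennreal (q y))) =
      (\<integral>\<^sup>+ y. ennreal (q y) * ennreal (p y / q y) \<partial>\<mu>)"
    by (rule nn_integral_density) auto
  also have "\<dots> \<le> (\<integral>\<^sup>+ y. ennreal (p y) \<partial>\<mu>)"
    using nn by (intro nn_integral_mono) (auto simp flip: ennreal_mult')
  finally show ?thesis .
qed

text \<open>Recasts the affinity inside \<open>renyi\<close> as the mean of a tempered likelihood
  ratio under the distribution with density \<open>q\<close>.\<close>

lemma nn_integral_powr_ratio_eq: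
  fixes p q :: "'x \<Rightarrow> real"
  assumes [measurable]: "p \<in> borel_measurable \<mu>" "q \<in> borel_measurable \<mu>"
    and nn: "\<And>y. y \<in> space \<mu> \<Longrightarrow> 0 \<le> p y" "\<And>y. y \<in> space \<mu> \<Longrightarrow> 0 \<le> q y"
  shows "(\<integral>\<^sup>+ y. ennreal (p y powr \<alpha> * q y powr (1 - \<alpha>)) \<partial>\<mu>) =
    (\<integral>\<^sup>+ y. ennreal ((p y / q y) powr \<alpha>) \<partial>density \<mu> (\<lambda>y. ennreal (q y)))"
proof -
  have "(\<integral>\<^sup>+ y. ennreal ((p y / q y) powr \<alpha>) \<partial>density \<mu> (\<lambda>y. ennreal (q y))) =
      (\<integral>\<^sup>+ y. ennreal (q y) * ennreal ((p y / q y) powr \<alpha>) \<partial>\<mu>)"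
    by (rule nn_integral_density) auto
  also have "\<dots> = (\<integral>\<^sup>+ y. ennreal (p y powr \<alpha> * q y powr (1 - \<alpha>)) \<partial>\<mu>)"
  proof (rule nn_integral_cong)
    fix y assume y: "y \<in> space \<mu>"
    \<comment> \<open>Where \<open>q y = 0\<close>, the factor \<open>q y\<close> kills the left
      side and \<open>0 powr (1 - \<alpha>) = 0\<close> kills the right side.\<close>
    have "q y * (p y / q y) powr \<alpha> = p y powr \<alpha> * q y powr (1 - \<alpha>)"
      using nn[OF y] by (cases "q y = 0") (auto simp: powr_divide powr_diff)
    then show "ennreal (q y) * ennreal ((p y / q y) powr \<alpha>) = ennreal (p y powr \<alpha> * q y powr (1 - \<alpha>))"
      using nn[OF y] by (simp flip: ennreal_mult')
  qed
  finally show ?thesis by simp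
qed

text \<open>This amounts to nonnegativity of the Renyi divergence: the power is replaced by its
  tangent, and the ratio \<open>p / q\<close> has mean at most 1.\<close>

lemma nn_integral_powr_ratio_le_1:
  fixes p q :: "'x \<Rightarrow> real"
  assumes [measurable]: "p \<in> borel_measurable \<mu>" "q \<in> borel_measurable \<mu>"
    and nn: "\<And>y. y \<in> space \<mu> \<Longrightarrow> 0 \<le> p y" "\<And>y. y \<in> space \<mu> \<Longrightarrow> 0 \<le> q y"
    and p1: "(\<integral>\<^sup>+ y. ennreal (p y) \<partial>\<mu>) = 1" and q1: "(\<integral>\<^sup>+ y. ennreal (q y) \<partial>\<mu>) = 1"
    and \<alpha>: "0 < \<alpha>" "\<alpha> < 1"
  shows "(\<integral>\<^sup>+ y. ennreal ((p y / q y) powr \<alpha>) \<partial>density \<mu> (\<lambda>y. ennreal (q y))) \<le> 1"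
proof -
  let ?Q = "density \<mu> (\<lambda>y. ennreal (q y))"
  have "emeasure ?Q (space ?Q) = 1" using q1 by (simp add: emeasure_density cong: nn_integral_cong)
  then interpret prob_space ?Q by (rule prob_spaceI)
  have "(\<integral>\<^sup>+ y. ennreal ((p y / q y) powr \<alpha>) \<partial>?Q) \<le>
      (\<integral>\<^sup>+ y. ennreal (1 - \<alpha>) + ennreal \<alpha> * ennreal (p y / q y) \<partial>?Q)"
  proof (rule nn_integral_mono)
    fix y assume "y \<in> space ?Q"
    then have "0 \<le> p y / q y" using nn by simp
    then have "ennreal ((p y / q y) powr \<alpha>) \<le> ennreal (1 - \<alpha> + \<alpha> * (p y / q y))"
      using \<alpha> by (intro ennreal_leI powr_le_affine)
    also have "\<dots> = ennreal (1 - \<alpha>) + ennreal \<alpha> * ennreal (p y / q y)"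
      using \<alpha> \<open>0 \<le> p y / q y\<close> mult_nonneg_nonneg[of \<alpha> "p y / q y"] by (subst ennreal_plus) (auto simp: ennreal_mult'[symmetric])
    finally show "ennreal ((p y / q y) powr \<alpha>) \<le> ennreal (1 - \<alpha>) + ennreal \<alpha> * ennreal (p y / q y)" .
  qed
  also have "\<dots> = ennreal (1 - \<alpha>) + ennreal \<alpha> * (\<integral>\<^sup>+ y. ennreal (p y / q y) \<partial>?Q)"
    using emeasure_space_1 by (simp add: nn_integral_add nn_integral_cmult)
  also have "\<dots> \<le> ennreal (1 - \<alpha>) + ennreal \<alpha> * 1"
    using nn_integral_ratio_le[of p \<mu> q] nn p1 by (intro add_left_mono mult_left_mono) auto
  also have "\<dots> = 1" using \<alpha> by (simp flip: ennreal_plus)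
  finally show ?thesis .
qed

section \<open>Kullback-Leibler divergence between densities, and log-ratios\<close>

text \<open>Replaces the abstract derivative in \<open>KL_div\<close> by the explicit ratio. If
  absolute continuity fails, \<open>p\<close> vanishes on a set of positive \<open>Q\<close>-mass
  where \<open>- elog 0 = \<infinity>\<close>, which reproduces the default value
  \<open>\<infinity>\<close>.\<close>

lemma KL_div_density:
  fixes \<mu> :: "'x measure" and p q :: "'x \<Rightarrow> real"
  defines "P \<equiv> density \<mu> (\<lambda>y. ennreal (p y))" and "Q \<equiv> density \<mu> (\<lambda>y. ennreal (q y))"
  assumes [measurable]: "p \<in> borel_measurable \<mu>" "q \<in> borel_measurable \<mu>"
    and nn: "\<And>y. y \<in> space \<mu> \<Longrightarrow> 0 \<le> p y" "\<And>y. y \<in> space \<mu> \<Longrightarrow> 0 \<le> q y"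
    and P: "prob_space P" and Q: "prob_space Q"
  shows "KL_div Q P = eintegral Q (\<lambda>y. - elog (p y / q y))"
proof -
  interpret P: prob_space P by fact
  interpret Q: prob_space Q by fact
  have s: "sets Q = sets P" by (simp add: P_def Q_def)
  have qpos: "AE y in Q. 0 < q y" unfolding Q_def by (subst AE_density) auto
  have q1: "(\<integral>\<^sup>+ y. ennreal (q y) \<partial>\<mu>) \<noteq> \<infinity>"
    using Q.emeasure_space_1 by (simp add: Q_def emeasure_density cong: nn_integral_cong)
  show ?thesis
  proof (cases "absolutely_continuous P Q")
    case True
    define f where "f = RN_deriv P Q"
    have [measurable]: "f \<in> borel_measurable \<mu>"
      using borel_measurable_RN_deriv[of P Q] by (simp add: f_def P_def)
    have "density \<mu> (\<lambda>y. ennreal (q y)) = density \<mu> (\<lambda>y. ennreal (p y) * f y)"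
      using P.density_RN_deriv[OF True s] by (simp add: P_def Q_def f_def[unfolded P_def Q_def] density_density_eq)
    \<comment> \<open>Two densities of \<open>Q\<close> relative to the arbitrary measure
      \<open>\<mu>\<close>; they agree almost everywhere because \<open>q1\<close> makes their
      integral finite.\<close>
    then have "AE y in \<mu>. ennreal (q y) = ennreal (p y) * f y"
      using q1 by (subst (asm) finite_density_unique) auto
    then have "AE y in Q. ennreal (q y) = ennreal (p y) * f y"
      unfolding Q_def by (subst AE_density) auto
    with qpos RN_deriv_pos_AE[OF Q P s True] AE_space
    have "AE y in Q. elog (enn2real (f y)) = - elog (p y / q y)"
    proof eventually_elim
      case (elim y)
      have y: "y \<in> space \<mu>" using elim(3) by (simp add: Q_def)
      obtain u where u: "f y = ennreal u" "0 < u" using elim(2) unfolding f_def by blast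
      have "q y = p y * u" using elim(4) u nn[OF y] by (simp flip: ennreal_mult')
      with elim(1) u nn[OF y] have "0 < p y" "p y / q y = 1 / u" by (auto simp: zero_less_mult_iff)
      then show ?case using u by (simp add: elog_def ln_div)
    qed
    then show ?thesis
      using s True unfolding KL_div_def f_def by (auto intro!: eintegral_cong_AE)
  next
    case False
    have "\<not> (AE y in Q. 0 < p y)"
    proof
      assume "AE y in Q. 0 < p y"
      then have *: "AE y in \<mu>. 0 < ennreal (q y) \<longrightarrow> 0 < p y" unfolding Q_def by (subst (asm) AE_density) auto
      have "absolutely_continuous P Q"
        unfolding absolutely_continuous_def
      proof
        fix N assume "N \<in> null_sets P"
        then have N: "N \<in> sets \<mu>" "AE y in \<mu>. y \<in> N \<longrightarrow> ennreal (p y) = 0"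
          unfolding P_def by (auto simp: null_sets_density_iff)
        have "AE y in \<mu>. y \<in> N \<longrightarrow> ennreal (q y) = 0"
          using N(2) * by eventually_elim (auto simp: ennreal_eq_0_iff not_less)
        with N show "N \<in> null_sets Q" unfolding Q_def by (auto simp: null_sets_density_iff)
      qed
      with False show False by simp
    qed
    then have "(\<integral>\<^sup>+ y. e2ennreal (- elog (p y / q y)) \<partial>Q) = \<infinity>"
    proof (rule contrapos_np)
      assume a: "(\<integral>\<^sup>+ y. e2ennreal (- elog (p y / q y)) \<partial>Q) \<noteq> \<infinity>"
      have "AE y in Q. e2ennreal (- elog (p y / q y)) \<noteq> \<infinity>"
        by (rule nn_integral_PInf_AE[OF _ a]) (simp add: Q_def)
      with qpos show "AE y in Q. 0 < p y"
        by eventually_elim (auto simp: elog_def zero_less_divide_iff split: if_splits)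
    qed
    then show ?thesis using False by (simp add: KL_div_def eintegral_def)
  qed
qed

text \<open>An absolute value is minus the number plus twice its positive part; the positive part of
  \<open>ln t\<close> is at most \<open>t\<close>, whose mean is at most 1, hence the constant 2.
  The resulting L1 bound is what Fubini needs once the divergence is averaged over
  parameters.\<close>

lemma integrable_ln_ratio:
  fixes \<mu> :: "'x measure" and p q :: "'x \<Rightarrow> real"
  defines "P \<equiv> density \<mu> (\<lambda>y. ennreal (p y))" and "Q \<equiv> density \<mu> (\<lambda>y. ennreal (q y))"
  assumes p[measurable]: "p \<in> borel_measurable \<mu>" and q[measurable]: "q \<in> borel_measurable \<mu>"
    and nn: "\<And>y. y \<in> space \<mu> \<Longrightarrow> 0 \<le> p y" "\<And>y. y \<in> space \<mu> \<Longrightarrow> 0 \<le> q y"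
    and P: "prob_space P" and Q: "prob_space Q" and fin: "KL_div Q P \<noteq> \<infinity>"
  shows "AE y in Q. 0 < p y" and "integrable Q (\<lambda>y. ln (p y / q y))"
    and "KL_div Q P = ereal (- (\<integral>y. ln (p y / q y) \<partial>Q))"
    and "(\<integral>\<^sup>+ y. ennreal \<bar>ln (p y / q y)\<bar> \<partial>Q) \<le> e2ennreal (KL_div Q P) + 2"
proof -
  interpret P: prob_space P by fact
  interpret Q: prob_space Q by fact
  have [measurable_cong]: "sets Q = sets \<mu>" by (simp add: Q_def)
  let ?t = "\<lambda>y. p y / q y"
  have KL: "KL_div Q P = eintegral Q (\<lambda>y. - elog (?t y))"
    unfolding P_def Q_def by (rule KL_div_density) (use nn P Q in \<open>auto simp: P_def Q_def\<close>)
  have p1: "(\<integral>\<^sup>+ y. ennreal (p y) \<partial>\<mu>) = 1"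
    using P.emeasure_space_1 by (simp add: P_def emeasure_density cong: nn_integral_cong)
  have t1: "(\<integral>\<^sup>+ y. ennreal (?t y) \<partial>Q) \<le> 1"
    using nn_integral_ratio_le[of p \<mu> q] nn p1 by (simp add: Q_def)
  have t0: "0 \<le> ?t y" if "y \<in> space Q" for y using that nn by (simp add: Q_def)
  have t_int: "integrable Q ?t"
    by (rule integrableI_nonneg) (use t1 t0 in \<open>auto intro!: AE_I2 simp: le_less_trans[of _ 1]\<close>)
  have t_le: "(\<integral>y. ?t y \<partial>Q) \<le> 1"
    using enn2real_mono[OF t1] t0 by (subst integral_eq_nn_integral) (auto intro!: AE_I2)
  \<comment> \<open>In \<open>ereal\<close>, \<open>\<infinity> - b = \<infinity>\<close> for every
    \<open>b\<close>, so a finite divergence rules out an infinite first part.\<close>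
  have "(\<integral>\<^sup>+ y. e2ennreal (- elog (?t y)) \<partial>Q) \<noteq> \<infinity>"
    using fin unfolding KL eintegral_def by auto
  then have ne: "eintegral Q (\<lambda>y. elog (?t y)) \<noteq> -\<infinity>"
    unfolding eintegral_def
    by (cases "\<integral>\<^sup>+ y. e2ennreal (- elog (?t y)) \<partial>Q"; cases "\<integral>\<^sup>+ y. e2ennreal (elog (?t y)) \<partial>Q")
       (auto simp: enn2ereal_ennreal)
  have elog_le: "elog (?t y) \<le> ereal (?t y)" for y
    using ln_le_minus_one[of "?t y"] by (auto simp: elog_def)
  have m: "(\<lambda>y. elog (?t y)) \<in> borel_measurable Q" by measurable
  note L = integrable_of_eintegral[OF m AE_I2[OF elog_le] t_int ne]
  have tpos: "AE y in Q. 0 < ?t y"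
    using L(1) by eventually_elim (auto simp: elog_def split: if_splits)
  show "AE y in Q. 0 < p y"
    using tpos AE_space
  proof eventually_elim
    case (elim y)
    then show ?case using nn[of y] by (auto simp: Q_def zero_less_divide_iff)
  qed
  have eq: "AE y in Q. real_of_ereal (elog (?t y)) = ln (?t y)"
    using tpos by eventually_elim (auto simp: elog_def)
  show int: "integrable Q (\<lambda>y. ln (?t y))"
    using L(2) eq by (subst (asm) integrable_cong_AE[where g = "\<lambda>y. ln (?t y)"]) auto
  have "KL_div Q P = eintegral Q (\<lambda>y. ereal (- ln (?t y)))"
    unfolding KL by (rule eintegral_cong_AE) (use tpos in \<open>auto simp: elog_def\<close>)
  also have "\<dots> = ereal (\<integral>y. - ln (?t y) \<partial>Q)" by (rule eintegral_ereal) (use int in simp)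
  finally show KL': "KL_div Q P = ereal (- (\<integral>y. ln (?t y) \<partial>Q))" using int by simp
  have "(\<integral>\<^sup>+ y. ennreal \<bar>ln (?t y)\<bar> \<partial>Q) = ennreal (\<integral>y. \<bar>ln (?t y)\<bar> \<partial>Q)"
    by (rule nn_integral_eq_integral) (use int in auto)
  also have "(\<integral>y. \<bar>ln (?t y)\<bar> \<partial>Q) \<le> - (\<integral>y. ln (?t y) \<partial>Q) + 2"
  proof -
    have gen: "(\<integral>y. \<bar>u y\<bar> \<partial>Q) \<le> - (\<integral>y. u y \<partial>Q) + 2"
      if "integrable Q u" "integrable Q v" "(\<integral>y. v y \<partial>Q) \<le> 1" "AE y in Q. \<bar>u y\<bar> \<le> - u y + 2 * v y"
      for u v :: "'x \<Rightarrow> real"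
    proof -
      have "(\<integral>y. \<bar>u y\<bar> \<partial>Q) \<le> (\<integral>y. - u y + 2 * v y \<partial>Q)"
        by (rule integral_mono_AE) (use that in auto)
      then show ?thesis using that by simp
    qed
    show ?thesis
    proof (rule gen[OF int t_int t_le], use tpos in eventually_elim)
      fix y assume "0 < ?t y"
      then show "\<bar>ln (?t y)\<bar> \<le> - ln (?t y) + 2 * ?t y"
        using ln_le_minus_one[of "?t y"] by linarith
    qed
  qed
  finally have "(\<integral>\<^sup>+ y. ennreal \<bar>ln (?t y)\<bar> \<partial>Q) \<le> ennreal (- (\<integral>y. ln (?t y) \<partial>Q) + 2)"
    by (simp add: ennreal_leI)
  also have "ennreal (- (\<integral>y. ln (?t y) \<partial>Q) + 2) \<le> ennreal (- (\<integral>y. ln (?t y) \<partial>Q)) + ennreal 2"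
    by (subst ennreal_plus_if) (auto intro: ennreal_leI)
  finally show "(\<integral>\<^sup>+ y. ennreal \<bar>ln (?t y)\<bar> \<partial>Q) \<le> e2ennreal (KL_div Q P) + 2"
    unfolding KL' by (simp add: ennreal_leI)
qed

text \<open>The L1 bound of \<open>integrable_ln_ratio\<close>, averaged over \<open>\<rho>\<close>,
  gives joint integrability of the log-ratio. Exchanging the integrals turns the averaged divergence
  into the mean of a function of a single observation.\<close>

lemma averaged_ln_ratio:
  fixes \<mu> :: "'x measure" and p :: "'p \<Rightarrow> 'x \<Rightarrow> real" and q :: "'x \<Rightarrow> real"
  defines "Q \<equiv> density \<mu> (\<lambda>y. ennreal (q y))"
  assumes \<rho>: "prob_space \<rho>" and Q: "prob_space Q"
    and p[measurable]: "(\<lambda>(\<theta>, y). p \<theta> y) \<in> borel_measurable (\<rho> \<Otimes>\<^sub>M \<mu>)"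
    and q[measurable]: "q \<in> borel_measurable \<mu>"
    and nn: "\<And>\<theta> y. \<theta> \<in> space \<rho> \<Longrightarrow> y \<in> space \<mu> \<Longrightarrow> 0 \<le> p \<theta> y" "\<And>y. y \<in> space \<mu> \<Longrightarrow> 0 \<le> q y"
    and P: "\<And>\<theta>. \<theta> \<in> space \<rho> \<Longrightarrow> prob_space (density \<mu> (\<lambda>y. ennreal (p \<theta> y)))"
    and r: "0 \<le> r" "(\<integral>\<^sup>+ \<theta>. e2ennreal (KL_div Q (density \<mu> (\<lambda>y. ennreal (p \<theta> y)))) \<partial>\<rho>) \<le> ennreal r"
  shows "AE y in Q. AE \<theta> in \<rho>. 0 < p \<theta> y"
    and "AE y in Q. integrable \<rho> (\<lambda>\<theta>. ln (p \<theta> y / q y))"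
    and "integrable Q (\<lambda>y. \<integral>\<theta>. ln (p \<theta> y / q y) \<partial>\<rho>)"
    and "- (\<integral>y. (\<integral>\<theta>. ln (p \<theta> y / q y) \<partial>\<rho>) \<partial>Q) \<le> r"
proof -
  interpret \<rho>: prob_space \<rho> by fact
  interpret Q: prob_space Q by fact
  interpret pair_sigma_finite \<rho> Q ..
  have [measurable_cong]: "sets Q = sets \<mu>" by (simp add: Q_def)
  let ?KL = "\<lambda>\<theta>. KL_div Q (density \<mu> (\<lambda>y. ennreal (p \<theta> y)))"
  have sect[measurable]: "p \<theta> \<in> borel_measurable \<mu>" if "\<theta> \<in> space \<rho>" for \<theta>
    using measurable_compose[OF measurable_Pair1'[OF that] p] by simp
  \<comment> \<open>Measurability in \<open>\<theta>\<close> is read off this formula, since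
    \<open>RN_deriv\<close> is a separate choice for each \<open>\<theta>\<close>.\<close>
  have KL_eq: "?KL \<theta> = eintegral Q (\<lambda>y. - elog (p \<theta> y / q y))" if "\<theta> \<in> space \<rho>" for \<theta>
    unfolding Q_def by (rule KL_div_density) (use that nn P Q in \<open>auto simp: Q_def\<close>)
  have "(\<lambda>\<theta>. eintegral Q (\<lambda>y. - elog (p \<theta> y / q y))) \<in> borel_measurable \<rho>"
    unfolding eintegral_def by measurable
  then have KL_meas[measurable]: "?KL \<in> borel_measurable \<rho>"
    using KL_eq by (simp cong: measurable_cong)
  have "AE \<theta> in \<rho>. e2ennreal (?KL \<theta>) \<noteq> \<infinity>"
    by (rule nn_integral_PInf_AE) (use r in \<open>auto simp: top_unique\<close>)
  then have fin: "AE \<theta> in \<rho>. \<theta> \<in> space \<rho> \<and> ?KL \<theta> \<noteq> \<infinity>"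
    using AE_space by eventually_elim auto
  note L = integrable_ln_ratio[OF sect q nn(1) nn(2) P Q[unfolded Q_def], folded Q_def]
  have "AE \<theta> in \<rho>. AE y in Q. 0 < p \<theta> y"
    using fin by eventually_elim (use L(1) in auto)
  then show "AE y in Q. AE \<theta> in \<rho>. 0 < p \<theta> y"
    by (subst (asm) AE_commute) auto
  have "(\<integral>\<^sup>+ z. ennreal (norm (case z of (\<theta>, y) \<Rightarrow> ln (p \<theta> y / q y))) \<partial>(\<rho> \<Otimes>\<^sub>M Q)) =
      (\<integral>\<^sup>+ \<theta>. \<integral>\<^sup>+ y. ennreal \<bar>ln (p \<theta> y / q y)\<bar> \<partial>Q \<partial>\<rho>)"
    by (subst Q.nn_integral_fst[symmetric]) auto
  also have "\<dots> \<le> (\<integral>\<^sup>+ \<theta>. e2ennreal (?KL \<theta>) + 2 \<partial>\<rho>)"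
    by (rule nn_integral_mono_AE, use fin in eventually_elim) (use L(4) in auto)
  also have "\<dots> = (\<integral>\<^sup>+ \<theta>. e2ennreal (?KL \<theta>) \<partial>\<rho>) + 2"
    by (subst nn_integral_add) (auto simp: \<rho>.emeasure_space_1)
  also have "\<dots> \<le> ennreal r + 2" using r by (intro add_right_mono)
  also have "\<dots> < \<infinity>" by (simp add: ennreal_add_less_top)
  finally have int: "integrable (\<rho> \<Otimes>\<^sub>M Q) (\<lambda>(\<theta>, y). ln (p \<theta> y / q y))"
    by (intro integrableI_bounded) auto
  show "AE y in Q. integrable \<rho> (\<lambda>\<theta>. ln (p \<theta> y / q y))" by (rule AE_integrable_snd[OF int])
  show "integrable Q (\<lambda>y. \<integral>\<theta>. ln (p \<theta> y / q y) \<partial>\<rho>)" by (rule integrable_snd[OF int])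
  define k where "k \<theta> = - (\<integral>y. ln (p \<theta> y / q y) \<partial>Q)" for \<theta>
  have k_int: "integrable \<rho> k" unfolding k_def using integrable_fst[OF int] by simp
  have "- (\<integral>y. (\<integral>\<theta>. ln (p \<theta> y / q y) \<partial>\<rho>) \<partial>Q) = (\<integral>\<theta>. k \<theta> \<partial>\<rho>)"
    using Fubini_integral[OF int] integrable_fst[OF int] by (simp add: k_def)
  \<comment> \<open>Discarding the negative part of \<open>k\<close> can only increase the
    integral.\<close>
  also have "\<dots> \<le> enn2real (\<integral>\<^sup>+ \<theta>. ennreal (k \<theta>) \<partial>\<rho>)"
    by (simp add: real_lebesgue_integral_def[OF k_int])
  also have "(\<integral>\<^sup>+ \<theta>. ennreal (k \<theta>) \<partial>\<rho>) = (\<integral>\<^sup>+ \<theta>. e2ennreal (?KL \<theta>) \<partial>\<rho>)"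
    by (rule nn_integral_cong_AE, use fin in eventually_elim) (metis L(3) e2ennreal_ereal k_def)
  also have "enn2real \<dots> \<le> r" using enn2real_mono[OF r(2)] r(1) by simp
  finally show "- (\<integral>y. (\<integral>\<theta>. ln (p \<theta> y / q y) \<partial>\<rho>) \<partial>Q) \<le> r" .
qed

section \<open>Likelihood ratios of the whole sample\<close>

text \<open>Independence turns the integral of the product into a power of one integral. Equality
  can fail when that integral is 0, as \<open>0 / 0 = 0\<close> in \<open>ennreal\<close>.\<close>

lemma nn_integral_normalized_prod_le_1:
  fixes g :: "'x \<Rightarrow> ennreal"
  assumes Q: "prob_space Q" and g[measurable]: "g \<in> borel_measurable Q" and fin: "(\<integral>\<^sup>+ y. g y \<partial>Q) \<noteq> \<infinity>"
  shows "(\<integral>\<^sup>+ x. (\<Prod>i<n. g (x i)) / (\<integral>\<^sup>+ y. g y \<partial>Q) ^ n \<partial>PiM {..<n} (\<lambda>_. Q)) \<le> 1"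
proof -
  interpret Q: prob_space Q by fact
  interpret product_sigma_finite "\<lambda>_. Q" ..
  let ?I = "\<integral>\<^sup>+ y. g y \<partial>Q"
  have "(\<integral>\<^sup>+ x. (\<Prod>i<n. g (x i)) / ?I ^ n \<partial>PiM {..<n} (\<lambda>_. Q)) =
      (\<integral>\<^sup>+ x. (\<Prod>i<n. g (x i)) \<partial>PiM {..<n} (\<lambda>_. Q)) / ?I ^ n"
    by (rule nn_integral_divide) measurable
  also have "(\<integral>\<^sup>+ x. (\<Prod>i<n. g (x i)) \<partial>PiM {..<n} (\<lambda>_. Q)) = ?I ^ n"
    by (subst product_nn_integral_prod) auto
  also have "?I ^ n / ?I ^ n \<le> 1"
  proof -
    have "a / a \<le> 1" if "a \<noteq> \<infinity>" for a :: ennreal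
      using that by (cases "a = 0") (auto simp: top.not_eq_extremum)
    then show ?thesis using fin by (simp add: power_eq_top_ennreal)
  qed
  finally show ?thesis .
qed

lemma loglik_real:
  assumes "\<And>i. i < n \<Longrightarrow> 0 < dens \<theta> (x i)"
  shows "loglik dens n x \<theta> = ereal (\<Sum>i<n. ln (dens \<theta> (x i)))"
  using assms by (simp add: loglik_def elog_def)

lemma loglik_minf:
  assumes "i < n" "\<not> 0 < dens \<theta> (x i)"
  shows "loglik dens n x \<theta> = -\<infinity>"
proof -
  have "(\<Sum>i<n. elog (dens \<theta> (x i))) = elog (dens \<theta> (x i)) + (\<Sum>j\<in>{..<n} - {i}. elog (dens \<theta> (x j)))"
    using assms by (intro sum.remove) auto
  \<comment> \<open>In \<open>ereal\<close>,
    \<open>-\<infinity> + \<infinity> = \<infinity>\<close>, so the remaining terms must be shown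
    not to reach \<open>\<infinity>\<close>.\<close>
  moreover have "(\<Sum>j\<in>{..<n} - {i}. elog (dens \<theta> (x j))) \<noteq> \<infinity>"
    by (simp add: sum_Pinfty elog_def)
  ultimately show ?thesis using assms by (auto simp: loglik_def elog_def)
qed

text \<open>Supplies the hypothesis \<open>ratio\<close> of \<open>variational_bound\<close>: in
  \<open>ln H\<close> the normalizer contributes \<open>- n * ln I\<close>, which is exactly
  \<open>n * (1 - \<alpha>)\<close> times the Renyi divergence. The degenerate outcomes are a
  vanishing density at some observation and a vanishing affinity.\<close>

lemma likelihood_ratio_cases:
  fixes dens :: "'p \<Rightarrow> 'x \<Rightarrow> real" and q :: "'x \<Rightarrow> real" and I :: ennreal
  assumes n: "0 < n" and \<alpha>: "0 < \<alpha>" "\<alpha> < 1" and q: "\<And>i. i < n \<Longrightarrow> 0 < q (x i)"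
    and I: "I = (\<integral>\<^sup>+ y. ennreal (dens \<theta> y powr \<alpha> * q y powr (1 - \<alpha>)) \<partial>\<mu>)" "I \<le> 1"
  defines "H \<equiv> (\<Prod>i<n. ennreal ((dens \<theta> (x i) / q (x i)) powr \<alpha>)) / I ^ n"
  shows "loglik dens n x \<theta> = -\<infinity> \<or> H = \<infinity> \<or>
    (\<exists>l h d. loglik dens n x \<theta> = ereal l \<and> H = ennreal h \<and> 0 < h \<and> renyi \<mu> \<alpha> (dens \<theta>) q = ereal d
      \<and> 0 \<le> d \<and> (real n * (1 - \<alpha>)) * d + \<alpha> * l = \<alpha> * (\<Sum>i<n. ln (q (x i))) + ln h)"
proof (cases "\<forall>i<n. 0 < dens \<theta> (x i)")
  case False
  then obtain i where "i < n" "\<not> 0 < dens \<theta> (x i)" by blast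
  then show ?thesis using loglik_minf[of i n dens \<theta> x] by simp
next
  case True
  define T where "T = (\<Prod>i<n. (dens \<theta> (x i) / q (x i)) powr \<alpha>)"
  have nz: "dens \<theta> (x i) \<noteq> 0" "q (x i) \<noteq> 0" if "i < n" for i using True q that by fastforce+
  have T: "0 < T" unfolding T_def by (intro prod_pos) (auto simp: nz)
  have HT: "H = ennreal T / I ^ n" unfolding H_def T_def by (simp add: prod_ennreal)
  have lnT: "ln T = \<alpha> * (\<Sum>i<n. ln (dens \<theta> (x i))) - \<alpha> * (\<Sum>i<n. ln (q (x i)))"
  proof -
    have "ln T = (\<Sum>i<n. ln ((dens \<theta> (x i) / q (x i)) powr \<alpha>))"
      unfolding T_def by (intro ln_prod) (auto simp: nz)
    also have "\<dots> = (\<Sum>i<n. \<alpha> * ln (dens \<theta> (x i)) - \<alpha> * ln (q (x i)))"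
      by (intro sum.cong refl) (use True q in \<open>simp add: nz ln_powr ln_div algebra_simps\<close>)
    finally show ?thesis by (simp add: sum_subtractf sum_distrib_left)
  qed
  show ?thesis
  proof (cases "I = 0")
    case I0: True
    \<comment> \<open>The divergence is infinite here; as \<open>0 < n\<close> and
      \<open>0 < T\<close>, division by \<open>I ^ n = 0\<close> gives
      \<open>H = \<infinity>\<close>.\<close>
    show ?thesis using I0 T HT n by (simp add: ennreal_divide_eq_top_iff power_0_left)
  next
    case False
    obtain I' where I': "I = ennreal I'" "0 < I'" "I' \<le> 1"
      using False I(2) by (cases I) (auto simp: less_le ennreal_le_1 top_unique)
    have H: "H = ennreal (T / I' ^ n)"
      using I' T unfolding HT by (simp add: ennreal_power divide_ennreal)
    have R: "renyi \<mu> \<alpha> (dens \<theta>) q = ereal (ln I' / (\<alpha> - 1))"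
      unfolding renyi_def I(1)[symmetric] Let_def using I' by simp
    have "real n * (1 - \<alpha>) * (ln I' / (\<alpha> - 1)) = - (real n * ln I')"
      using \<alpha> by (simp add: field_simps)
    moreover have "ln (T / I' ^ n) = ln T - real n * ln I'"
      using T I' by (simp add: ln_div ln_realpow)
    moreover have "0 \<le> ln I' / (\<alpha> - 1)"
      using I' \<alpha> by (intro divide_nonpos_neg) auto
    moreover have "0 < T / I' ^ n" using T I' by simp
    ultimately show ?thesis
      using loglik_real[of n dens \<theta> x] True H R lnT
      by (intro disjI2 exI[of _ "\<Sum>i<n. ln (dens \<theta> (x i))"] exI[of _ "T / I' ^ n"] exI[of _ "ln I' / (\<alpha> - 1)"]) auto
  qed
qed

section \<open>The Renyi risk of the selected variational approximation\<close>

theorem theorem3: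
  fixes \<mu> :: "'x measure"
    and \<Theta> :: "nat \<Rightarrow> 'p measure"
    and dens :: "'p \<Rightarrow> 'x \<Rightarrow> real"
    and w :: "nat \<Rightarrow> real"
    and Pri :: "nat \<Rightarrow> 'p measure"
    and F :: "nat \<Rightarrow> 'p measure set"
    and \<alpha> r :: real and n K0 :: nat and \<theta>0 :: 'p
    and \<rho>0 :: "'p measure"
    and \<rho>t :: "nat \<Rightarrow> (nat \<Rightarrow> 'x) \<Rightarrow> 'p measure"
    and Khat :: "(nat \<Rightarrow> 'x) \<Rightarrow> nat"
  defines "P0 \<equiv> Pdist \<mu> dens \<theta>0"
  defines "ELBO \<equiv> \<lambda>K x. elbo_obj \<alpha> (Pri K) (loglik dens n x) (\<rho>t K x)"
  assumes dens_nonneg: "\<And>K \<theta> y. K \<ge> 1 \<Longrightarrow> \<theta> \<in> space (\<Theta> K) \<Longrightarrow> y \<in> space \<mu> \<Longrightarrow> 0 \<le> dens \<theta> y"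
    and dens_meas: "\<And>K. K \<ge> 1 \<Longrightarrow> (\<lambda>(\<theta>, y). dens \<theta> y) \<in> borel_measurable (\<Theta> K \<Otimes>\<^sub>M \<mu>)"
    and dens_prob: "\<And>K \<theta>. K \<ge> 1 \<Longrightarrow> \<theta> \<in> space (\<Theta> K) \<Longrightarrow> (\<integral>\<^sup>+ y. ennreal (dens \<theta> y) \<partial>\<mu>) = 1"
    and w_pos: "\<And>K. K \<ge> 1 \<Longrightarrow> 0 < w K"
    and w_sum: "(\<lambda>K. w (Suc K)) sums 1"
    and prior: "\<And>K. K \<ge> 1 \<Longrightarrow> prob_space (Pri K) \<and> sets (Pri K) = sets (\<Theta> K)"
    and F_prob: "\<And>K \<rho>. K \<ge> 1 \<Longrightarrow> \<rho> \<in> F K \<Longrightarrow> prob_space \<rho> \<and> sets \<rho> = sets (\<Theta> K)"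
    and \<alpha>: "0 < \<alpha>" "\<alpha> < 1"
    and n: "1 \<le> n"
    and \<rho>t_opt: "\<And>K x. K \<ge> 1 \<Longrightarrow> x \<in> space (PiM {..<n} (\<lambda>_. P0)) \<Longrightarrow>
        \<rho>t K x \<in> F K \<and>
        (\<forall>\<rho>\<in>F K. elbo_obj \<alpha> (Pri K) (loglik dens n x) \<rho> \<le> ELBO K x)"
    and Khat_opt: "\<And>x. x \<in> space (PiM {..<n} (\<lambda>_. P0)) \<Longrightarrow>
        Khat x \<ge> 1 \<and>
        (\<forall>K\<ge>1. ELBO K x - ereal (ln (1 / w K)) \<le> ELBO (Khat x) x - ereal (ln (1 / w (Khat x))))"
    and K0: "K0 \<ge> 1" and \<theta>0: "\<theta>0 \<in> space (\<Theta> K0)"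
    and r: "0 < r"
    and \<rho>0: "\<rho>0 \<in> F K0"
    and \<rho>0_KL: "(\<integral>\<^sup>+ \<theta>. e2ennreal (KL_div P0 (Pdist \<mu> dens \<theta>)) \<partial>\<rho>0) \<le> ennreal r"
    and \<rho>0_prior: "KL_div \<rho>0 (Pri K0) \<le> ereal (real n * r)"
  shows "(\<integral>\<^sup>+ x. (\<integral>\<^sup>+ \<theta>. e2ennreal (renyi \<mu> \<alpha> (dens \<theta>) (dens \<theta>0)) \<partial>(\<rho>t (Khat x) x))
            \<partial>(PiM {..<n} (\<lambda>_. P0)))
         \<le> ennreal ((1 + \<alpha>) / (1 - \<alpha>) * r + ln (1 / w K0) / (real n * (1 - \<alpha>)))"
proof -
  let ?q = "dens \<theta>0"
  let ?X = "PiM {..<n} (\<lambda>_. P0)"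
  have sect: "dens \<theta> \<in> borel_measurable \<mu>" if "K \<ge> 1" "\<theta> \<in> space (\<Theta> K)" for K \<theta>
    using measurable_compose[OF measurable_Pair1'[OF that(2)] dens_meas[OF that(1)]] by simp
  have prob: "prob_space (density \<mu> (\<lambda>y. ennreal (dens \<theta> y)))" if "K \<ge> 1" "\<theta> \<in> space (\<Theta> K)" for K \<theta>
    by (rule prob_spaceI)
      (use sect[OF that] dens_prob[OF that] in \<open>simp add: emeasure_density cong: nn_integral_cong\<close>)
  have P0_eq: "P0 = density \<mu> (\<lambda>y. ennreal (?q y))" by (simp add: P0_def Pdist_def)
  note q_meas[measurable] = sect[OF K0 \<theta>0]
  note q_nn = dens_nonneg[OF K0 \<theta>0]
  interpret P0: prob_space P0 unfolding P0_eq by (rule prob[OF K0 \<theta>0])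
  interpret X: prob_space ?X by (rule prob_space_PiM) unfold_locales
  have P0_sets[measurable_cong]: "sets P0 = sets \<mu>" by (simp add: P0_eq)
  have P0_space: "space P0 = space \<mu>" by (simp add: P0_eq)
  have space_Pri: "space (Pri K) = space (\<Theta> K)" if "K \<ge> 1" for K
    using prior[OF that] sets_eq_imp_space_eq by blast

  \<comment> \<open>Normalized tempered likelihood ratios and their measurability\<close>
  define I where "I \<theta> = (\<integral>\<^sup>+ y. ennreal (dens \<theta> y powr \<alpha> * ?q y powr (1 - \<alpha>)) \<partial>\<mu>)" for \<theta>
  define H where "H \<theta> x = (\<Prod>i<n. ennreal ((dens \<theta> (x i) / ?q (x i)) powr \<alpha>)) / I \<theta> ^ n" for \<theta> x
  have I_eq: "I \<theta> = (\<integral>\<^sup>+ y. ennreal ((dens \<theta> y / ?q y) powr \<alpha>) \<partial>P0)"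
    if "K \<ge> 1" "\<theta> \<in> space (\<Theta> K)" for K \<theta>
    unfolding I_def P0_eq
    by (rule nn_integral_powr_ratio_eq) (use sect[OF that] dens_nonneg[OF that] q_nn in auto)
  have I_le: "I \<theta> \<le> 1" if "K \<ge> 1" "\<theta> \<in> space (\<Theta> K)" for K \<theta>
    unfolding I_eq[OF that] P0_eq
    by (rule nn_integral_powr_ratio_le_1)
      (use sect[OF that] dens_nonneg[OF that] dens_prob[OF that] dens_prob[OF K0 \<theta>0] q_nn \<alpha> in auto)
  have I_meas: "I \<in> borel_measurable (Pri K)" if K: "K \<ge> 1" for K
  proof -
    have [measurable_cong]: "sets (Pri K) = sets (\<Theta> K)" using prior[OF K] by simp
    note [measurable] = dens_meas[OF K]
    \<comment> \<open>Measurability of a parameter integral rests on a sigma-finite measure, so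
      \<open>I\<close> is taken in its form as an integral against \<open>P0\<close>.\<close>
    have "(\<lambda>\<theta>. \<integral>\<^sup>+ y. ennreal ((dens \<theta> y / ?q y) powr \<alpha>) \<partial>P0) \<in> borel_measurable (Pri K)"
      by measurable
    then show ?thesis
      by (rule measurable_cong[THEN iffD2, rotated]) (use I_eq[OF K] space_Pri[OF K] in simp)
  qed
  have H_meas: "(\<lambda>(\<theta>, x). H \<theta> x) \<in> borel_measurable (Pri K \<Otimes>\<^sub>M ?X)" if K: "K \<ge> 1" for K
  proof -
    have [measurable_cong]: "sets (Pri K) = sets (\<Theta> K)" using prior[OF K] by simp
    note [measurable] = dens_meas[OF K] I_meas[OF K]
    show ?thesis unfolding H_def by measurable
  qed
  have H_sect: "(\<lambda>\<theta>. H \<theta> x) \<in> borel_measurable (Pri K)" if "K \<ge> 1" "x \<in> space ?X" for K x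
    using measurable_compose[OF measurable_Pair2'[OF that(2)] H_meas[OF that(1)]] by simp
  have ll_meas: "loglik dens n x \<in> borel_measurable (Pri K)" if K: "K \<ge> 1" and x: "x \<in> space ?X" for K x
  proof -
    have [measurable_cong]: "sets (Pri K) = sets (\<Theta> K)" using prior[OF K] by simp
    have "(\<lambda>\<theta>. dens \<theta> (x i)) \<in> borel_measurable (Pri K)" if "i < n" for i
    proof -
      have "x i \<in> space \<mu>" using x that by (auto simp: space_PiM P0_space)
      then have "(\<lambda>\<theta>. dens \<theta> (x i)) \<in> borel_measurable (\<Theta> K)"
        using measurable_compose[OF measurable_Pair2' dens_meas[OF K]] by simp
      then show ?thesis by measurable
    qed
    then show ?thesis
      unfolding loglik_def by (intro borel_measurable_ereal_sum measurable_compose[OF _ borel_measurable_elog]) auto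
  qed

  \<comment> \<open>The mixture over all models\<close>
  \<comment> \<open>Models are numbered from 1, hence \<open>Suc k\<close> in a series starting at
    0.\<close>
  define Z where "Z x = (\<Sum>k. ennreal (w (Suc k)) * (\<integral>\<^sup>+ \<theta>. H \<theta> x \<partial>Pri (Suc k)))" for x
  have HI_meas[measurable]: "(\<lambda>x. \<integral>\<^sup>+ \<theta>. H \<theta> x \<partial>Pri (Suc k)) \<in> borel_measurable ?X" for k
  proof -
    interpret Pk: prob_space "Pri (Suc k)" using prior[of "Suc k"] by simp
    have "(\<lambda>(x, \<theta>). H \<theta> x) \<in> borel_measurable (?X \<Otimes>\<^sub>M Pri (Suc k))"
      using measurable_compose[OF measurable_pair_swap' H_meas[of "Suc k"]] by (simp add: case_prod_unfold)
    then show ?thesis by measurable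
  qed
  have Z_meas[measurable]: "Z \<in> borel_measurable ?X" unfolding Z_def by measurable
  have HI_le: "(\<integral>\<^sup>+ x. (\<integral>\<^sup>+ \<theta>. H \<theta> x \<partial>Pri (Suc k)) \<partial>?X) \<le> 1" for k
  proof -
    interpret Pk: prob_space "Pri (Suc k)" using prior[of "Suc k"] by simp
    interpret pair_sigma_finite "Pri (Suc k)" ?X ..
    have "(\<integral>\<^sup>+ x. (\<integral>\<^sup>+ \<theta>. H \<theta> x \<partial>Pri (Suc k)) \<partial>?X) = (\<integral>\<^sup>+ \<theta>. (\<integral>\<^sup>+ x. H \<theta> x \<partial>?X) \<partial>Pri (Suc k))"
      using Fubini[OF H_meas[of "Suc k"]] by simp
    also have "\<dots> \<le> (\<integral>\<^sup>+ \<theta>. 1 \<partial>Pri (Suc k))"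
    proof (rule nn_integral_mono)
      fix \<theta> assume "\<theta> \<in> space (Pri (Suc k))"
      then have \<theta>: "\<theta> \<in> space (\<Theta> (Suc k))" using space_Pri[of "Suc k"] by simp
      have [measurable]: "dens \<theta> \<in> borel_measurable \<mu>" by (rule sect[OF _ \<theta>]) simp
      have "(\<integral>\<^sup>+ y. ennreal ((dens \<theta> y / ?q y) powr \<alpha>) \<partial>P0) \<noteq> \<infinity>"
        using I_le[OF _ \<theta>] I_eq[OF _ \<theta>] by (auto simp: top_unique)
      then show "(\<integral>\<^sup>+ x. H \<theta> x \<partial>?X) \<le> 1"
        using I_eq[OF _ \<theta>] unfolding H_def
        by (simp add: nn_integral_normalized_prod_le_1[OF P0.prob_space_axioms, of "\<lambda>y. ennreal ((dens \<theta> y / ?q y) powr \<alpha>)"])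
    qed
    also have "\<dots> = 1" by (simp add: Pk.emeasure_space_1)
    finally show ?thesis .
  qed
  have w_suminf: "(\<Sum>k. ennreal (w (Suc k))) = 1"
    using suminf_ennreal_eq[OF less_imp_le[OF w_pos] w_sum] by simp
  have Z_le: "(\<integral>\<^sup>+ x. Z x \<partial>?X) \<le> 1"
  proof -
    have "(\<integral>\<^sup>+ x. Z x \<partial>?X) = (\<Sum>k. \<integral>\<^sup>+ x. ennreal (w (Suc k)) * (\<integral>\<^sup>+ \<theta>. H \<theta> x \<partial>Pri (Suc k)) \<partial>?X)"
      unfolding Z_def by (rule nn_integral_suminf) measurable
    also have "\<dots> = (\<Sum>k. ennreal (w (Suc k)) * (\<integral>\<^sup>+ x. (\<integral>\<^sup>+ \<theta>. H \<theta> x \<partial>Pri (Suc k)) \<partial>?X))"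
      by (simp add: nn_integral_cmult)
    also have "\<dots> \<le> (\<Sum>k. ennreal (w (Suc k)))"
    proof (rule suminf_le)
      show "ennreal (w (Suc k)) * (\<integral>\<^sup>+ x. (\<integral>\<^sup>+ \<theta>. H \<theta> x \<partial>Pri (Suc k)) \<partial>?X) \<le> ennreal (w (Suc k))" for k
        using mult_left_mono[OF HI_le[of k], of "ennreal (w (Suc k))"] by simp
    qed auto
    finally show ?thesis using w_suminf by simp
  qed
  have Z_fin: "AE x in ?X. Z x \<noteq> \<infinity>"
    by (rule nn_integral_PInf_AE) (use Z_le in \<open>auto simp: top_unique\<close>)
  have Z_int: "integrable ?X (\<lambda>x. enn2real (Z x))" and Z_exp: "(\<integral>x. enn2real (Z x) \<partial>?X) \<le> 1"
  proof -
    have "(\<integral>\<^sup>+ x. ennreal (enn2real (Z x)) \<partial>?X) \<le> (\<integral>\<^sup>+ x. Z x \<partial>?X)"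
      by (rule nn_integral_mono) (simp add: ennreal_enn2real_if)
    with Z_le have *: "(\<integral>\<^sup>+ x. ennreal (enn2real (Z x)) \<partial>?X) \<le> 1" by (rule order_trans[rotated])
    then show "integrable ?X (\<lambda>x. enn2real (Z x))"
      by (intro integrableI_nonneg) (auto simp: le_less_trans[of _ 1])
    show "(\<integral>x. enn2real (Z x) \<partial>?X) \<le> 1"
      using enn2real_mono[OF *] by (subst integral_eq_nn_integral) auto
  qed
  \<comment> \<open>Each model contributes one nonnegative term of the series, so the same
    \<open>Z x\<close> serves every \<open>K\<close>, including one chosen from the data.\<close>
  have Z_ge: "ennreal (w K) * (\<integral>\<^sup>+ \<theta>. H \<theta> x \<partial>Pri K) \<le> Z x" if "K \<ge> 1" for K x
  proof -
    define k where "k = K - 1"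
    have k: "K = Suc k" using that by (simp add: k_def)
    have "(\<Sum>j\<in>{k}. ennreal (w (Suc j)) * (\<integral>\<^sup>+ \<theta>. H \<theta> x \<partial>Pri (Suc j))) \<le> Z x"
      unfolding Z_def by (rule sum_le_suminf) auto
    then show ?thesis by (simp add: k)
  qed

  \<comment> \<open>The reference distribution in the true model\<close>
  have \<rho>0_prob: "prob_space \<rho>0" and \<rho>0_sets[measurable_cong]: "sets \<rho>0 = sets (\<Theta> K0)"
    using F_prob[OF K0 \<rho>0] by auto
  have \<rho>0_space: "space \<rho>0 = space (\<Theta> K0)" using \<rho>0_sets by (rule sets_eq_imp_space_eq)
  interpret \<rho>0: prob_space \<rho>0 by fact
  \<comment> \<open>The log-ratio at one observation averaged over \<open>\<rho>0\<close>; minus its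
    mean is the averaged divergence, at most \<open>r\<close>.\<close>
  define \<kappa> where "\<kappa> y = (\<integral>\<theta>. ln (dens \<theta> y / ?q y) \<partial>\<rho>0)" for y
  have \<kappa>: "AE y in P0. AE \<theta> in \<rho>0. 0 < dens \<theta> y"
    "AE y in P0. integrable \<rho>0 (\<lambda>\<theta>. ln (dens \<theta> y / ?q y))"
    "integrable P0 \<kappa>" "- (\<integral>y. \<kappa> y \<partial>P0) \<le> r"
  proof -
    have m: "(\<lambda>(\<theta>, y). dens \<theta> y) \<in> borel_measurable (\<rho>0 \<Otimes>\<^sub>M \<mu>)"
      using dens_meas[OF K0] by measurable
    note A = averaged_ln_ratio[OF \<rho>0_prob _ m q_meas, folded P0_eq, OF P0.prob_space_axioms _ _ _ less_imp_le[OF r]]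
    show "AE y in P0. AE \<theta> in \<rho>0. 0 < dens \<theta> y"
      "AE y in P0. integrable \<rho>0 (\<lambda>\<theta>. ln (dens \<theta> y / ?q y))"
      "integrable P0 \<kappa>" "- (\<integral>y. \<kappa> y \<partial>P0) \<le> r"
      unfolding \<kappa>_def
      using dens_nonneg[OF K0] q_nn prob[OF K0] \<rho>0_KL by (auto intro!: A simp: \<rho>0_space Pdist_def)
  qed
  have q_pos: "AE y in P0. 0 < ?q y" unfolding P0_eq by (subst AE_density) auto
  have component: "distr ?X P0 (\<lambda>x. x i) = P0" if "i < n" for i
    using that P0.prob_space_axioms by (intro distr_PiM_component) auto
  \<comment> \<open>The exceptional null sets for one observation are pulled back along each of the
    finitely many coordinates.\<close>
  have "AE x in ?X. \<forall>i\<in>{..<n}. 0 < ?q (x i) \<and> (AE \<theta> in \<rho>0. 0 < dens \<theta> (x i)) \<and>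
      integrable \<rho>0 (\<lambda>\<theta>. ln (dens \<theta> (x i) / ?q (x i)))"
  proof (rule AE_finite_allI)
    fix i assume i: "i \<in> {..<n}"
    have "AE y in P0. 0 < ?q y \<and> (AE \<theta> in \<rho>0. 0 < dens \<theta> y) \<and> integrable \<rho>0 (\<lambda>\<theta>. ln (dens \<theta> y / ?q y))"
      using q_pos \<kappa>(1,2) by eventually_elim auto
    then show "AE x in ?X. 0 < ?q (x i) \<and> (AE \<theta> in \<rho>0. 0 < dens \<theta> (x i)) \<and>
      integrable \<rho>0 (\<lambda>\<theta>. ln (dens \<theta> (x i) / ?q (x i)))"
      by (rule AE_PiM_component[OF P0.prob_space_axioms i])
  qed simp
  then have good: "AE x in ?X. (\<forall>i<n. 0 < ?q (x i) \<and> (AE \<theta> in \<rho>0. 0 < dens \<theta> (x i)) \<and>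
      integrable \<rho>0 (\<lambda>\<theta>. ln (dens \<theta> (x i) / ?q (x i)))) \<and> Z x \<noteq> \<infinity> \<and> x \<in> space ?X"
    using Z_fin AE_space by eventually_elim auto

  \<comment> \<open>The bound for a fixed sample\<close>
  define c where "c = real n * (1 - \<alpha>)"
  have c: "0 < c" using n \<alpha> by (simp add: c_def)
  \<comment> \<open>This is the bound of \<open>variational_bound\<close> for the selected model
    after insertion of the lower bound for its ELBO: the log-likelihood at \<open>\<theta>0\<close>
    and the selected penalty cancel, and \<open>Z\<close> replaces the term of that model. Neither
    \<open>Khat\<close> nor \<open>\<rho>t\<close> is left.\<close>
  define B where "B x = - \<alpha> * (\<Sum>i<n. \<kappa> (x i)) + real n * r + ln (1 / w K0) + enn2real (Z x) - 1" for x
  have pointwise: "AE x in ?X. 0 \<le> B x / c \<and>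
      (\<integral>\<^sup>+ \<theta>. e2ennreal (renyi \<mu> \<alpha> (dens \<theta>) ?q) \<partial>(\<rho>t (Khat x) x)) \<le> ennreal (B x / c)"
    using good
  proof eventually_elim
    case (elim x)
    then have x: "x \<in> space ?X" and Zx: "Z x \<noteq> \<infinity>" and qx: "\<And>i. i < n \<Longrightarrow> 0 < ?q (x i)"
      and dx: "\<And>i. i < n \<Longrightarrow> AE \<theta> in \<rho>0. 0 < dens \<theta> (x i)"
      and ix: "\<And>i. i < n \<Longrightarrow> integrable \<rho>0 (\<lambda>\<theta>. ln (dens \<theta> (x i) / ?q (x i)))" by auto
    define K where "K = Khat x"
    define a where "a = \<alpha> * (\<Sum>i<n. ln (?q (x i)))"
    \<comment> \<open>A lower bound for the objective at \<open>\<rho>0\<close>: the expected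
      log-likelihood is split into its value at \<open>\<theta>0\<close> plus the averaged
      log-ratios, and the prior divergence is bounded by \<open>n * r\<close>.\<close>
    define e0 where "e0 = a + \<alpha> * (\<Sum>i<n. \<kappa> (x i)) - real n * r"
    have K: "K \<ge> 1" and K_opt: "ELBO K0 x - ereal (ln (1 / w K0)) \<le> ELBO K x - ereal (ln (1 / w K))"
      using Khat_opt[OF x] K0 by (auto simp: K_def)
    have "ereal e0 \<le> elbo_obj \<alpha> (Pri K0) (loglik dens n x) \<rho>0"
    proof -
      have KLf: "KL_div \<rho>0 (Pri K0) \<noteq> \<infinity>" using \<rho>0_prior by auto
      obtain k where k: "KL_div \<rho>0 (Pri K0) = ereal k"
        using KL_div_finiteD(4)[OF \<rho>0_prob _ KLf] prior[OF K0] by blast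
      \<comment> \<open>Each log-density is split because \<open>ix\<close> gives
        \<open>\<rho>0\<close>-integrability for the ratios, while the remaining summand is constant
        in \<open>\<theta>\<close>.\<close>
      let ?l = "\<lambda>\<theta>. \<Sum>i<n. ln (dens \<theta> (x i) / ?q (x i)) + ln (?q (x i))"
      have "AE \<theta> in \<rho>0. \<forall>i\<in>{..<n}. 0 < dens \<theta> (x i)"
        by (rule AE_finite_allI) (use dx in auto)
      then have "AE \<theta> in \<rho>0. loglik dens n x \<theta> = ereal (?l \<theta>)"
      proof eventually_elim
        case (elim \<theta>)
        have "(\<Sum>i<n. ln (dens \<theta> (x i))) = ?l \<theta>"
        proof (rule sum.cong[OF refl])
          fix i assume "i \<in> {..<n}"
          then have "0 < dens \<theta> (x i)" "0 < ?q (x i)" using elim qx by auto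
          then show "ln (dens \<theta> (x i)) = ln (dens \<theta> (x i) / ?q (x i)) + ln (?q (x i))"
            by (simp add: ln_div)
        qed
        then show ?case using elim by (simp add: loglik_real)
      qed
      then have "eintegral \<rho>0 (loglik dens n x) = eintegral \<rho>0 (\<lambda>\<theta>. ereal (?l \<theta>))"
        by (rule eintegral_cong_AE)
      also have "\<dots> = ereal (\<integral>\<theta>. ?l \<theta> \<partial>\<rho>0)"
        by (rule eintegral_ereal) (use ix in \<open>auto intro!: Bochner_Integration.integrable_sum\<close>)
      also have "(\<integral>\<theta>. ?l \<theta> \<partial>\<rho>0) = (\<Sum>i<n. \<kappa> (x i) + ln (?q (x i)))"
        using ix by (subst Bochner_Integration.integral_sum) (auto simp: \<kappa>_def \<rho>0.prob_space)
      finally show ?thesis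
        using k \<rho>0_prior by (simp add: elbo_obj_def e0_def a_def sum.distrib algebra_simps)
    qed
    then have "ereal e0 \<le> ELBO K0 x" using \<rho>t_opt[OF K0 x] \<rho>0 by (blast intro: order_trans)
    \<comment> \<open>Optimality of \<open>Khat\<close> is rearranged in \<open>ereal\<close>, so
      infinite values of either ELBO are treated as separate cases.\<close>
    then have e: "ereal (e0 - ln (1 / w K0) + ln (1 / w K)) \<le> elbo_obj \<alpha> (Pri K) (loglik dens n x) (\<rho>t K x)"
      using K_opt unfolding ELBO_def
      by (cases "elbo_obj \<alpha> (Pri K0) (loglik dens n x) (\<rho>t K0 x)";
          cases "elbo_obj \<alpha> (Pri K) (loglik dens n x) (\<rho>t K x)") auto
    have HK: "(\<integral>\<^sup>+ \<theta>. H \<theta> x \<partial>Pri K) \<noteq> \<infinity>"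
      using Z_ge[OF K, of x] Zx w_pos[OF K] by (auto simp: top_unique ennreal_mult_eq_top_iff)
    have wH: "w K * enn2real (\<integral>\<^sup>+ \<theta>. H \<theta> x \<partial>Pri K) \<le> enn2real (Z x)"
      using enn2real_mono[OF Z_ge[OF K, of x]] Zx w_pos[OF K]
      by (simp add: enn2real_mult top.not_eq_extremum)
    let ?S = "a - (e0 - ln (1 / w K0) + ln (1 / w K)) + ln (1 / w K) + w K * enn2real (\<integral>\<^sup>+ \<theta>. H \<theta> x \<partial>Pri K) - 1"
    have "prob_space (\<rho>t K x)" using F_prob[OF K] \<rho>t_opt[OF K x] by blast
    moreover have "prob_space (Pri K)" using prior[OF K] by simp
    moreover have "loglik dens n x \<theta> = -\<infinity> \<or> H \<theta> x = \<infinity> \<or>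
      (\<exists>l h d. loglik dens n x \<theta> = ereal l \<and> H \<theta> x = ennreal h \<and> 0 < h \<and> renyi \<mu> \<alpha> (dens \<theta>) ?q = ereal d
        \<and> 0 \<le> d \<and> c * d + \<alpha> * l = a + ln h)" if "\<theta> \<in> space (Pri K)" for \<theta>
      unfolding H_def c_def a_def using that space_Pri[OF K] n \<alpha> qx I_le[OF K]
      by (intro likelihood_ratio_cases) (auto simp: I_def)
    ultimately have S0: "0 \<le> ?S"
      and le: "(\<integral>\<^sup>+ \<theta>. e2ennreal (renyi \<mu> \<alpha> (dens \<theta>) ?q) \<partial>(\<rho>t K x)) \<le> ennreal (?S / c)"
      using variational_bound[of "\<rho>t K x" "Pri K" "loglik dens n x" "\<lambda>\<theta>. H \<theta> x" \<alpha> c "w K"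
          "\<lambda>\<theta>. renyi \<mu> \<alpha> (dens \<theta>) ?q" a, OF _ _ ll_meas[OF K x] H_sect[OF K x] \<alpha>(1) c w_pos[OF K] HK _ e] by blast+
    have S: "?S \<le> B x" using wH by (simp add: B_def e0_def)
    then have "?S / c \<le> B x / c" using c by (simp only: divide_right_mono less_imp_le)
    then have "(\<integral>\<^sup>+ \<theta>. e2ennreal (renyi \<mu> \<alpha> (dens \<theta>) ?q) \<partial>(\<rho>t K x)) \<le> ennreal (B x / c)"
      by (rule order_trans[OF le ennreal_leI])
    moreover have "0 \<le> B x" using S0 S by (rule order_trans)
    ultimately show ?case using c by (simp add: K_def)
  qed

  \<comment> \<open>Taking expectations over the sample\<close>
  have \<kappa>_comp: "integrable ?X (\<lambda>x. \<kappa> (x i))" "(\<integral>x. \<kappa> (x i) \<partial>?X) = (\<integral>y. \<kappa> y \<partial>P0)" if "i < n" for i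
  proof -
    have [measurable]: "(\<lambda>x. x i) \<in> measurable ?X P0" using that by (intro measurable_component_singleton) simp
    show "integrable ?X (\<lambda>x. \<kappa> (x i))"
      using integrable_distr[of "\<lambda>x. x i" ?X P0 \<kappa>] component[OF that] \<kappa>(3) by simp
    show "(\<integral>x. \<kappa> (x i) \<partial>?X) = (\<integral>y. \<kappa> y \<partial>P0)"
      using integral_distr[of "\<lambda>x. x i" ?X P0 \<kappa>] component[OF that] \<kappa>(3) by simp
  qed
  have S_int: "integrable ?X (\<lambda>x. \<Sum>i<n. \<kappa> (x i))" using \<kappa>_comp by auto
  have B_int: "integrable ?X B" unfolding B_def using S_int Z_int by auto
  have "(\<integral>x. B x \<partial>?X) = - \<alpha> * (\<integral>x. (\<Sum>i<n. \<kappa> (x i)) \<partial>?X) + real n * r + ln (1 / w K0) + (\<integral>x. enn2real (Z x) \<partial>?X) - 1"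
    unfolding B_def using S_int Z_int by (simp add: X.prob_space)
  also have "(\<integral>x. (\<Sum>i<n. \<kappa> (x i)) \<partial>?X) = real n * (\<integral>y. \<kappa> y \<partial>P0)"
    using \<kappa>_comp by (subst Bochner_Integration.integral_sum) auto
  \<comment> \<open>The mean of \<open>Z\<close> is at most 1 and is absorbed by the
    \<open>- 1\<close> in \<open>B\<close>.\<close>
  finally have "(\<integral>x. B x \<partial>?X) \<le> (\<alpha> * real n) * (- (\<integral>y. \<kappa> y \<partial>P0)) + real n * r + ln (1 / w K0)"
    using Z_exp by simp
  \<comment> \<open>The factor \<open>1 + \<alpha>\<close> arises here: \<alpha> from the averaged
    log-ratios and 1 from the divergence of \<open>\<rho>0\<close> from its prior.\<close>
  also have "\<dots> \<le> (\<alpha> * real n) * r + real n * r + ln (1 / w K0)"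
    using \<kappa>(4) \<alpha> by (intro add_right_mono mult_left_mono) auto
  finally have "(\<integral>x. B x \<partial>?X) / c \<le> ((\<alpha> * real n) * r + real n * r + ln (1 / w K0)) / c"
    using c by (simp add: divide_right_mono)
  also have "\<dots> = (1 + \<alpha>) / (1 - \<alpha>) * r + ln (1 / w K0) / (real n * (1 - \<alpha>))"
  proof -
    have "(\<alpha> * real n) * r + real n * r + ln (1 / w K0) = real n * ((1 + \<alpha>) * r) + ln (1 / w K0)"
      by (simp add: algebra_simps)
    moreover have "real n * ((1 + \<alpha>) * r) / c = (1 + \<alpha>) / (1 - \<alpha>) * r"
      using n by (simp add: c_def)
    ultimately show ?thesis by (simp add: add_divide_distrib c_def)
  qed
  finally have fin: "(\<integral>x. B x / c \<partial>?X) \<le> (1 + \<alpha>) / (1 - \<alpha>) * r + ln (1 / w K0) / (real n * (1 - \<alpha>))"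
    by simp

  have "(\<integral>\<^sup>+ x. (\<integral>\<^sup>+ \<theta>. e2ennreal (renyi \<mu> \<alpha> (dens \<theta>) ?q) \<partial>(\<rho>t (Khat x) x)) \<partial>?X) \<le> (\<integral>\<^sup>+ x. ennreal (B x / c) \<partial>?X)"
    by (rule nn_integral_mono_AE) (use pointwise in auto)
  \<comment> \<open>Nonnegativity of \<open>B x / c\<close>, carried along in
    \<open>pointwise\<close>, ensures that \<open>ennreal\<close> truncates nothing outside a null
    set.\<close>
  also have "\<dots> = ennreal (\<integral>x. B x / c \<partial>?X)"
    by (rule nn_integral_eq_integral) (use B_int pointwise in auto)
  also have "\<dots> \<le> ennreal ((1 + \<alpha>) / (1 - \<alpha>) * r + ln (1 / w K0) / (real n * (1 - \<alpha>)))"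
    using fin by (rule ennreal_leI)
  finally show ?thesis .
qed

end
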